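(* Let $\nu\in[0,1]$ and let $\mathcal{M}$ be a $p$-order tensor method on $\mathbb{R}^n$ satisfying Assumption 1 (see context). Assume that for any convex $p$-times differentiable function $f:\mathbb{R}^n\to\mathbb{R}$ that attains its minimum and satisfies $H_{f,p}(\nu)<+\infty$ this method ensures the rate of convergence $$\min_{1\le k\le t-1}\|\nabla f(x_k)\|_*\le\frac{H_{f,p}(\nu)\|x_0-x^*\|^{p+\nu-1}}{\kappa(t)},\qquad t\ge2,$$ where $\{x_k\}_{k\ge0}$ is the sequence generated by $\mathcal{M}$ and $x^*$ is a global minimizer of $f$. Then, for all $t\ge2$ such that $t+1\le n$, $$\kappa(t)\le L_{p,\nu}(t+1)^{\frac{3(p+\nu)-2}{2}}\quad\text{with}\quad L_{p,\nu}=2^{\frac{2+\nu}{2}}\,3^{-\frac{p+\nu-1}{2}}\prod_{i=0}^{p-1}(p+\nu-i).$$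
   Context: Here $\mathbb{E}=\mathbb{R}^n$ with $B=I_n$, so $\|\cdot\|$ and $\|\cdot\|_*$ are the standard Euclidean norm; $p\ge1$ is an integer with $p+\nu\ge2$; $\kappa(t)>0$. $D^if(x)[h]^i$ is the $i$th directional derivative of $f$ at $x$ along $h$; the norm of a symmetric $p$-linear form $A$ is $\max\{|A[h_1,\ldots,h_p]|:\|h_i\|\le1\}$; $H_{f,p}(\nu)=\sup_{x\ne y}\|D^pf(x)-D^pf(y)\|/\|x-y\|^\nu$. For $\bar x\in\mathbb{R}^n$, $a\in\mathbb{R}^p$, $\gamma>0$, $q>1$ let $\phi_{a,\gamma,q}(h)=\sum_{i=1}^pa^{(i)}D^if(\bar x)[h]^i+\gamma\|h\|^q$, let $\Gamma_{\bar x,f}(a,\gamma,q)$ be the set of all stationary points of $\phi_{a,\gamma,q}$, and let $S_f(\bar x)$ be the linear span of the union of all $\Gamma_{\bar x,f}(a,\gamma,q)$ over $a\in\mathbb{R}^p,\gamma>0,q>1$. **Assumption 1.** Given $x_0\in\mathbb{R}^n$, the method generates a sequence of test points $\{x_k\}_{k\ge0}$ such that $x_{k+1}\in x_0+\sum_{i=0}^kS_f(x_i)$ for all $k\ge0$. *)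

theory Defs
  imports "HOL-Analysis.Analysis"
begin

definition gradient :: "('a::real_inner \<Rightarrow> real) \<Rightarrow> 'a \<Rightarrow> 'a" where
  "gradient f x = (THE g. GDERIV f x :> g)"

lemma gradient_eq:
  assumes "GDERIV f x :> g"
  shows "gradient f x = g"
  unfolding gradient_def
proof (rule the_equality)
  fix g' assume "GDERIV f x :> g'"
  then have "(\<lambda>h. inner h g') = (\<lambda>h. inner h g)"
    using assms unfolding gderiv_def by (rule has_derivative_unique)
  then show "g' = g"
    by (metis inner_commute vector_eq_ldot)
qed (fact assms)

text \<open>\<open>nth_deriv f [h\<^sub>1, \<dots>, h\<^sub>i] x\<close> is $D^i f(x)[h_1, \dots, h_i]$; the order of the
  derivative is the length of the list of directions.\<close>
primrec nth_deriv :: "('a::real_normed_vector \<Rightarrow> real) \<Rightarrow> 'a list \<Rightarrow> 'a \<Rightarrow> real" where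
  "nth_deriv f [] = f"
| "nth_deriv f (h # hs) = (\<lambda>x. frechet_derivative (nth_deriv f hs) (at x) h)"

text \<open>Differentiability of the form-valued map $x \mapsto D^i f(x)$, expressed through all its
  evaluations; in finite dimension this is the same as Frechet differentiability into the space
  of $i$-linear forms.\<close>
definition times_differentiable :: "nat \<Rightarrow> ('a::euclidean_space \<Rightarrow> real) \<Rightarrow> bool" where
  "times_differentiable p f \<longleftrightarrow>
     (\<forall>hs x. length hs < p \<longrightarrow> nth_deriv f hs differentiable (at x))"

text \<open>For a $p$-linear form on a finite-dimensional space the supremum is a maximum.\<close>
definition form_norm :: "nat \<Rightarrow> ('a::euclidean_space list \<Rightarrow> real) \<Rightarrow> real" where
  "form_norm p A = (SUP hs\<in>{hs. length hs = p \<and> (\<forall>h\<in>set hs. norm h \<le> 1)}. \<bar>A hs\<bar>)"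

definition holder_const :: "nat \<Rightarrow> real \<Rightarrow> ('a::euclidean_space \<Rightarrow> real) \<Rightarrow> ennreal" where
  "holder_const p \<nu> f =
     (SUP (x, y)\<in>{(x, y). x \<noteq> y}.
        ennreal (form_norm p (\<lambda>hs. nth_deriv f hs x - nth_deriv f hs y) / norm (x - y) powr \<nu>))"

definition global_minimizer :: "('a \<Rightarrow> real) \<Rightarrow> 'a \<Rightarrow> bool" where
  "global_minimizer f x \<longleftrightarrow> (\<forall>y. f x \<le> f y)"

definition problem_class :: "nat \<Rightarrow> real \<Rightarrow> ('a::euclidean_space \<Rightarrow> real) set" where
  "problem_class p \<nu> =
     {f. convex_on UNIV f \<and> times_differentiable p f \<and> (\<exists>x. global_minimizer f x) \<and>
         holder_const p \<nu> f < \<infinity>}"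

text \<open>The coefficient vector $a \in \mathbb{R}^p$ is a function on \<open>nat\<close> of which only the
  values at $1, \dots, p$ are used.\<close>
definition model :: "nat \<Rightarrow> ('a::euclidean_space \<Rightarrow> real) \<Rightarrow> 'a \<Rightarrow> (nat \<Rightarrow> real) \<Rightarrow> real \<Rightarrow> real
    \<Rightarrow> 'a \<Rightarrow> real" where
  "model p f x a \<gamma> q h =
     (\<Sum>i=1..p. a i * nth_deriv f (replicate i h) x) + \<gamma> * norm h powr q"

definition stationary_points :: "nat \<Rightarrow> ('a::euclidean_space \<Rightarrow> real) \<Rightarrow> 'a \<Rightarrow> (nat \<Rightarrow> real) \<Rightarrow> real
    \<Rightarrow> real \<Rightarrow> 'a set" where
  "stationary_points p f x a \<gamma> q = {h. GDERIV (model p f x a \<gamma> q) h :> 0}"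

definition step_space :: "nat \<Rightarrow> ('a::euclidean_space \<Rightarrow> real) \<Rightarrow> 'a \<Rightarrow> 'a set" where
  "step_space p f x =
     span (\<Union>{stationary_points p f x a \<gamma> q | a \<gamma> q. \<gamma> > 0 \<and> q > 1})"

text \<open>A method maps an objective and a starting point to its sequence of test points. No further
  restriction (such as access to the objective through an oracle) is imposed. The sum
  ranges over sets, i.e. it is a Minkowski sum of subspaces.\<close>
type_synonym 'a opt_method = "('a \<Rightarrow> real) \<Rightarrow> 'a \<Rightarrow> nat \<Rightarrow> 'a"

definition tensor_method :: "nat \<Rightarrow> real \<Rightarrow> 'a::euclidean_space opt_method \<Rightarrow> bool" where
  "tensor_method p \<nu> M \<longleftrightarrow>
     (\<forall>f\<in>problem_class p \<nu>. \<forall>x0. M f x0 0 = x0 \<and>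
        (\<forall>k. M f x0 (Suc k) \<in> x0 +o (\<Sum>i=0..k. step_space p f (M f x0 i))))"

definition lower_const :: "nat \<Rightarrow> real \<Rightarrow> real" where
  "lower_const p \<nu> =
     2 powr ((2 + \<nu>) / 2) * 3 powr (- ((real p + \<nu> - 1) / 2)) *
     (\<Prod>i=0..<p. real p + \<nu> - real i)"

end

theory Submission
  imports Defs
begin

text \<open>
  The bound is witnessed by one convex function that every method confined to the spaces
  \<open>step_space\<close> can explore only one coordinate per iteration. Let \<open>b\<^sub>0, \<dots>, b\<^sub>N\<^sub>-\<^sub>1\<close> be orthonormal with
  \<open>N = t\<close>, put \<open>b\<^sub>N = 0\<close> and \<open>v\<^sub>j = b\<^sub>j - \<rho> b\<^sub>j\<^sub>+\<^sub>1\<close> for some \<open>\<rho> \<in> (0, 1]\<close>, and consider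
  \<open>f x = (\<Sum>j<N. \<rho>\<^sup>j g (v\<^sub>j \<bullet> x)) - b\<^sub>0 \<bullet> x\<close>, where \<open>g\<close> is convex, all its derivatives up to order \<open>p\<close>
  vanish at 0, and \<open>g' 1 = 1\<close>.

  If the coordinates of \<open>x\<close> from index \<open>k\<close> on vanish, then \<open>v\<^sub>j \<bullet> x = 0\<close> for \<open>j \<ge> k\<close>, hence the Taylor
  polynomial of \<open>f\<close> at \<open>x\<close> involves only \<open>b\<^sub>0, \<dots>, b\<^sub>k\<close>, and so does every stationary point of a
  regularised model (\<open>step_space_reach\<close>). Started at 0, the method has therefore not seen the last
  coordinate after \<open>t - 1\<close> steps. On such points the gradient has inner product -1 with the
  vector \<open>u = (\<Sum>j<N. \<rho>\<^sup>-\<^sup>j b\<^sub>j)\<close>, which is orthogonal to all links but the last; the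
  norm of the gradient is thus at least \<open>1 / norm u\<close> (\<open>gradient_lower_bound\<close>). The minimizer is the point where all \<open>v\<^sub>j \<bullet> x\<close>
  equal 1, because there the tangents of the summands add up to the linear term
  (\<open>global_minimizer_chain\<close>). Together with a bound on the Hoelder constant of the \<open>p\<close>-th derivative,
  \<open>C (1 + \<rho>\<^sup>2)\<^bsup>(p+\<nu>-2)/2\<^esup> (1 + \<rho>)\<^sup>2\<close> where \<open>C\<close> is that of \<open>g\<close>, the assumed rate becomes an explicit upper
  bound on \<open>\<kappa> t\<close> (\<open>rate_bound\<close>).

  Two choices remain. The classical profile \<open>g s = (max 0 s)\<^bsup>p+\<nu>\<^esup> / (p + \<nu>)\<close> has
  \<open>C = (p + \<nu> - 1) \<dots> (\<nu> + 1)\<close>, and cutting it off at the negative half line keeps \<open>C\<close> independent of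
  the parity of \<open>p\<close>. For \<open>\<nu> = 0\<close> it fails to be \<open>p\<close> times differentiable at 0;
  there a family of functions whose \<open>p\<close>-th derivative is a steep ramp takes its place,
  and the bound follows in the limit of infinite steepness (\<open>rate_bound_all_orders\<close>).

  As to \<open>\<rho>\<close>, the undamped chain \<open>\<rho> = 1\<close> yields the asserted constant as long as \<open>2\<^bsup>p/2\<^esup> \<le> p + \<nu>\<close>,
  which holds for all \<open>\<nu>\<close> only up to \<open>p = 4\<close>: each derivative contributes the norm \<open>sqrt 2\<close> of a link. For \<open>p \<ge> 5\<close> the choice
  \<open>\<rho> = (t - 1) / (t + 1)\<close> shortens the minimizer, whose norm enters with the power \<open>p + \<nu> - 1\<close>, by
  a factor that makes up for this loss, while the gradient bound deteriorates by no more than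
  a constant factor (\<open>damped_chain_constant\<close>).
\<close>

section \<open>One-dimensional profiles\<close>

lemma pos_part_powr_deriv:
  fixes a s :: real
  assumes "1 < a"
  shows "((\<lambda>s. max 0 s powr a) has_real_derivative a * max 0 s powr (a - 1)) (at s)"
proof (cases s "0::real" rule: linorder_cases)
  case less
  have "((\<lambda>s. 0) has_real_derivative a * max 0 s powr (a - 1)) (at s)"
    using less by (auto intro!: derivative_eq_intros)
  then show ?thesis
    by (rule has_field_derivative_transform_within_open[of _ _ _ "{..<0}"]) (use less in auto)
next
  case greater
  have "((\<lambda>s. s powr a) has_real_derivative a * max 0 s powr (a - 1)) (at s)"
    using greater by (auto intro!: derivative_eq_intros has_real_derivative_powr)
  then show ?thesis
    by (rule has_field_derivative_transform_within_open[of _ _ _ "{0<..}"]) (use greater in auto)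
next
  case equal
  have "((\<lambda>h. max 0 h powr a / h) \<longlongrightarrow> 0) (at 0)"
  proof (rule Lim_null_comparison)
    show "\<forall>\<^sub>F h in at 0. norm (max 0 h powr a / h) \<le> \<bar>h\<bar> powr (a - 1)"
      by (intro always_eventually allI)
        (auto simp: max_def powr_diff abs_mult divide_simps powr_add)
    have "((\<lambda>h. \<bar>h\<bar> powr (a - 1)) \<longlongrightarrow> \<bar>0\<bar> powr (a - 1)) (at (0::real))"
      using assms by (intro tendsto_powr2 tendsto_intros always_eventually) auto
    then show "((\<lambda>h. \<bar>h\<bar> powr (a - 1)) \<longlongrightarrow> 0) (at (0::real))" by simp
  qed
  then show ?thesis using equal by (simp add: DERIV_def)
qed

lemma powr_holder:
  fixes x y a :: real
  assumes "0 \<le> x" "0 \<le> y" "0 < a" "a \<le> 1"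
  shows "\<bar>x powr a - y powr a\<bar> \<le> \<bar>x - y\<bar> powr a"
proof -
  have *: "y powr a \<le> x powr a + (y - x) powr a" if "0 \<le> x" "x \<le> y" for x y :: real
  proof (cases "y = 0")
    case False
    then have y: "y > 0" using that by auto
    \<comment> \<open>After division by \<open>y\<close>, the two parts of \<open>y\<close> become numbers in the unit interval with sum 1.\<close>
    have lin: "s \<le> s powr a" if "0 \<le> s" "s \<le> 1" for s :: real
      using powr_mono'[of a 1 s] that assms by simp
    have "1 = x / y + (y - x) / y" using y by (simp add: divide_simps)
    also have "\<dots> \<le> (x / y) powr a + ((y - x) / y) powr a"
      using that y by (intro add_mono lin) (auto simp: divide_simps)
    finally have "y powr a * 1 \<le> y powr a * ((x / y) powr a + ((y - x) / y) powr a)"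
      by (intro mult_left_mono) auto
    then show ?thesis using that y by (simp add: powr_divide distrib_left)
  qed (use that in auto)
  show ?thesis
  proof (cases "x \<le> y")
    case True
    then show ?thesis using *[of x y] powr_mono2[of a x y] assms by (simp add: abs_if)
  next
    case False
    then show ?thesis using *[of y x] powr_mono2[of a y x] assms by (simp add: abs_if)
  qed
qed

text \<open>
  \<open>g i\<close> is the \<open>i\<close>-th derivative of the convex function \<open>g 0\<close>. Flatness at 0 is what hides a summand
  \<open>g 0 (v \<bullet> x)\<close> from all \<open>p\<close> derivatives at points with \<open>v \<bullet> x = 0\<close>; the normalisation of the slope
  places the minimizer.
\<close>

locale ridge_kernel =
  fixes p :: nat and \<nu> C :: real and g :: "nat \<Rightarrow> real \<Rightarrow> real"
  assumes p_pos: "1 \<le> p" and \<nu>_nonneg: "0 \<le> \<nu>" and \<nu>_le_1: "\<nu> \<le> 1" and order_ge_2: "2 \<le> real p + \<nu>"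
    and C_nonneg: "0 \<le> C"
    and deriv: "i < p \<Longrightarrow> (g i has_real_derivative g (Suc i) s) (at s)"
    and flat: "i \<le> p \<Longrightarrow> g i 0 = 0"
    and slope_mono: "s \<le> r \<Longrightarrow> g 1 s \<le> g 1 r"
    and slope_1: "g 1 1 = 1"
    and holder: "\<bar>g p s - g p r\<bar> \<le> C * \<bar>s - r\<bar> powr \<nu>"

text \<open>
  The \<open>i\<close>-th derivative of the function \<open>(max 0 s)\<^sup>q / q\<close>.
\<close>

definition power_kernel :: "real \<Rightarrow> nat \<Rightarrow> real \<Rightarrow> real" where
  "power_kernel q i s = (\<Prod>j<i. q - real j) / q * max 0 s powr (q - real i)"

lemma power_kernel_deriv:
  assumes "real i + 1 < q"
  shows "(power_kernel q i has_real_derivative power_kernel q (Suc i) s) (at s)"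
proof -
  have "((\<lambda>s. (\<Prod>j<i. q - real j) / q * max 0 s powr (q - real i)) has_real_derivative
      (\<Prod>j<i. q - real j) / q * ((q - real i) * max 0 s powr (q - real i - 1))) (at s)"
    using assms by (intro DERIV_cmult pos_part_powr_deriv) auto
  then show ?thesis
    unfolding power_kernel_def using assms by (simp add: field_simps)
qed

lemma power_kernel_0 [simp]: "power_kernel q i 0 = 0"
  by (simp add: power_kernel_def)

lemma power_kernel_mono:
  assumes "real i \<le> q" "s \<le> r"
  shows "power_kernel q i s \<le> power_kernel q i r"
  unfolding power_kernel_def using assms
  by (intro mult_left_mono powr_mono2 divide_nonneg_nonneg prod_nonneg) auto

lemma ridge_kernel_power:
  assumes "1 \<le> p" "0 < \<nu>" "\<nu> \<le> 1" "2 \<le> real p + \<nu>"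
  shows "ridge_kernel p \<nu> ((\<Prod>i=1..<p. real p + \<nu> - real i)) (power_kernel (real p + \<nu>))"
proof
  show "power_kernel (real p + \<nu>) 1 1 = 1"
    using assms by (simp add: power_kernel_def)
  fix s r :: real
  show "s \<le> r \<Longrightarrow> power_kernel (real p + \<nu>) 1 s \<le> power_kernel (real p + \<nu>) 1 r"
    using assms by (intro power_kernel_mono) auto
  let ?c = "\<Prod>i=1..<p. real p + \<nu> - real i"
  show c: "0 \<le> ?c" using assms by (intro prod_nonneg) auto
  \<comment> \<open>The factor with index 0 cancels against the denominator \<open>q\<close>.\<close>
  have "(\<Prod>i<p. real p + \<nu> - real i) = (real p + \<nu>) * ?c"
    using assms(1) by (simp add: lessThan_atLeast0 prod.atLeast_Suc_lessThan[of 0 p])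
  then have top: "power_kernel (real p + \<nu>) p s = ?c * max 0 s powr \<nu>" for s
    using assms by (simp add: power_kernel_def)
  have "\<bar>power_kernel (real p + \<nu>) p s - power_kernel (real p + \<nu>) p r\<bar>
      = ?c * \<bar>max 0 s powr \<nu> - max 0 r powr \<nu>\<bar>"
    using c by (simp add: top abs_mult flip: right_diff_distrib)
  also have "\<dots> \<le> ?c * \<bar>max 0 s - max 0 r\<bar> powr \<nu>"
    using assms c by (intro mult_left_mono powr_holder) auto
  also have "\<dots> \<le> ?c * \<bar>s - r\<bar> powr \<nu>"
    using assms c by (intro mult_left_mono powr_mono2) (auto simp: max_def)
  finally show "\<bar>power_kernel (real p + \<nu>) p s - power_kernel (real p + \<nu>) p r\<bar> \<le> ?c * \<bar>s - r\<bar> powr \<nu>" .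
qed (use assms power_kernel_deriv in auto)

text \<open>
  A difference quotient with step \<open>\<epsilon>\<close> of the power kernel of exponent \<open>p + 1\<close>, which makes the \<open>p\<close>-th
  derivative a bounded ramp: zero up to 0, constant from \<open>\<epsilon>\<close> on, and linear in between. The
  denominator normalises the slope at 1.
\<close>

definition ramp_kernel :: "real \<Rightarrow> nat \<Rightarrow> nat \<Rightarrow> real \<Rightarrow> real" where
  "ramp_kernel \<epsilon> p i s =
     (power_kernel (real p + 1) i s - power_kernel (real p + 1) i (s - \<epsilon>)) / (1 - (1 - \<epsilon>) ^ p)"

text \<open>
  For exponent \<open>\<nu> = 0\<close> the Hoelder constant is just the oscillation of the \<open>p\<close>-th derivative, that is
  the height of the ramp. As \<open>\<epsilon>\<close> tends to 0 it decreases to \<open>fact (p - 1)\<close>.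
\<close>

lemma ridge_kernel_ramp:
  assumes "2 \<le> p" "0 < \<epsilon>" "\<epsilon> < 1"
  shows "ridge_kernel p 0 (fact p * \<epsilon> / (1 - (1 - \<epsilon>) ^ p)) (ramp_kernel \<epsilon> p)"
proof
  let ?P = "power_kernel (real p + 1)" and ?d = "1 - (1 - \<epsilon>) ^ p"
  have d: "0 < ?d" using assms by (simp add: power_less_one_iff)
  show "0 \<le> fact p * \<epsilon> / ?d" using assms d by simp
  show der: "(ramp_kernel \<epsilon> p i has_real_derivative ramp_kernel \<epsilon> p (Suc i) s) (at s)"
    if "i < p" for i s
  proof -
    have *: "(?P i has_real_derivative ?P (Suc i) s) (at s)" for s
      using that by (intro power_kernel_deriv) auto
    have "((\<lambda>s. ?P i (s - \<epsilon>)) has_real_derivative ?P (Suc i) (s - \<epsilon>) * 1) (at s)"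
      by (rule DERIV_chain2[OF *]) (auto intro!: derivative_eq_intros)
    then show ?thesis
      unfolding ramp_kernel_def using * by (auto intro!: DERIV_cdivide DERIV_diff)
  qed
  show "ramp_kernel \<epsilon> p i 0 = 0" for i
    using assms by (simp add: ramp_kernel_def power_kernel_def)
  have nonneg: "0 \<le> ramp_kernel \<epsilon> p i s" if "i \<le> p" for i s
    unfolding ramp_kernel_def using that assms d power_kernel_mono[of i "real p + 1" "s - \<epsilon>" s] by simp
  show "ramp_kernel \<epsilon> p 1 s \<le> ramp_kernel \<epsilon> p 1 r" if "s \<le> r" for s r
    using that by (rule DERIV_nonneg_imp_nondecreasing) (use der[of 1] nonneg[of 2] assms in \<open>auto simp: numeral_2_eq_2\<close>)
  show "ramp_kernel \<epsilon> p 1 1 = 1"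
    using assms d by (simp add: ramp_kernel_def power_kernel_def powr_realpow)
  have "(\<Prod>j<k. real j + 2) = fact (Suc k)" for k
    by (induction k) (auto simp: algebra_simps)
  moreover have "(\<Prod>j<p. real p + 1 - real j) = (\<Prod>j<p. real j + 2)"
    by (subst prod.nat_diff_reindex[symmetric]) (auto intro!: prod.cong simp: of_nat_diff)
  ultimately have "(\<Prod>j<p. real p + 1 - real j) / (real p + 1) = fact p"
    by (simp add: divide_simps)
  then have top: "ramp_kernel \<epsilon> p p s = fact p * (max 0 s - max 0 (s - \<epsilon>)) / ?d" for s
    by (simp add: ramp_kernel_def power_kernel_def right_diff_distrib)
  have le: "ramp_kernel \<epsilon> p p s \<le> fact p * \<epsilon> / ?d" for s
    unfolding top using d assms by (intro divide_right_mono mult_left_mono) auto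
  show "\<bar>ramp_kernel \<epsilon> p p s - ramp_kernel \<epsilon> p p r\<bar> \<le> fact p * \<epsilon> / ?d * \<bar>s - r\<bar> powr 0" for s r
    using le[of s] le[of r] nonneg[of p s] nonneg[of p r] by (cases "s = r") (auto simp: abs_if)
qed (use assms in auto)

section \<open>Ridge sums, stationary points and orthonormal families\<close>

text \<open>
  Each differentiation of \<open>g i (v j \<bullet> x)\<close> in direction \<open>h\<close> raises \<open>i\<close> and brings out a factor
  \<open>v j \<bullet> h\<close>. The candidate \<open>D\<close> satisfies this recursion, so that it agrees with the iterated derivatives
  by induction on the list of directions.
\<close>

lemma nth_deriv_ridge_sum:
  fixes v :: "nat \<Rightarrow> 'a::euclidean_space" and c :: 'a and w :: "nat \<Rightarrow> real" and N :: nat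
  assumes deriv: "\<And>i s. i < p \<Longrightarrow> (g i has_real_derivative g (Suc i) s) (at s)"
  defines "f \<equiv> \<lambda>x. (\<Sum>j<N. w j * g 0 (v j \<bullet> x)) - c \<bullet> x"
  defines "D \<equiv> \<lambda>hs x. (\<Sum>j<N. w j * g (length hs) (v j \<bullet> x) * (\<Prod>h\<leftarrow>hs. v j \<bullet> h))
      - (case hs of [] \<Rightarrow> c \<bullet> x | [h] \<Rightarrow> c \<bullet> h | _ \<Rightarrow> 0)"
  shows "length hs \<le> p \<Longrightarrow> nth_deriv f hs = D hs"
    and "length hs < p \<Longrightarrow> (D hs has_derivative (\<lambda>h. D (h # hs) x)) (at x)"
proof -
  have der: "(D hs has_derivative (\<lambda>h. D (h # hs) x)) (at x)" if "length hs < p" for hs x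
  proof -
    have 1: "((\<lambda>x. g (length hs) (v j \<bullet> x)) has_derivative
        (\<lambda>h. g (Suc (length hs)) (v j \<bullet> x) * (v j \<bullet> h))) (at x)" for j
      using has_derivative_compose[OF bounded_linear_imp_has_derivative[OF bounded_linear_inner_right]
          deriv[OF that, unfolded has_field_derivative_def], of "v j" x UNIV]
      by simp
    have 2: "((\<lambda>x. case hs of [] \<Rightarrow> c \<bullet> x | [h] \<Rightarrow> c \<bullet> h | _ \<Rightarrow> 0) has_derivative
        (\<lambda>h. case h # hs of [] \<Rightarrow> c \<bullet> x | [h] \<Rightarrow> c \<bullet> h | _ \<Rightarrow> 0)) (at x)"
      by (cases hs; cases "tl hs") (auto intro!: derivative_eq_intros)
    show ?thesis
      unfolding D_def
      by (rule derivative_eq_intros 1 2 refl | simp)+ (simp add: mult_ac)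
  qed
  then show "length hs < p \<Longrightarrow> (D hs has_derivative (\<lambda>h. D (h # hs) x)) (at x)" .
  show "length hs \<le> p \<Longrightarrow> nth_deriv f hs = D hs"
  proof (induction hs)
    case Nil
    show ?case by (simp add: f_def D_def)
  next
    case (Cons h hs)
    then have "nth_deriv f hs = D hs" by simp
    then have "nth_deriv f (h # hs) x = D (h # hs) x" for x
      using frechet_derivative_at[OF der[of hs x]] Cons.prems by simp metis
    then show ?case by blast
  qed
qed

text \<open>
  Along a line on which \<open>P\<close> is constant the model reduces to the power of the norm, whose only
  stationary point on that line is the foot of the perpendicular from the origin.
\<close>

lemma orthogonal_if_stationary_along:
  fixes h d :: "'a::euclidean_space"
  assumes stat: "GDERIV (\<lambda>h. P h + \<gamma> * norm h powr q) h :> 0"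
    and const: "\<And>s. P (h + s *\<^sub>R d) = P h" and "\<gamma> > 0" "q > 1"
  shows "d \<bullet> h = 0"
proof (cases "h = 0")
  case False
  have line: "((\<lambda>s. h + s *\<^sub>R d) has_derivative (\<lambda>s. s *\<^sub>R d)) (at 0)"
    by (auto intro!: derivative_eq_intros)
  have "((\<lambda>s. P (h + s *\<^sub>R d) + \<gamma> * norm (h + s *\<^sub>R d) powr q) has_derivative (\<lambda>s. 0)) (at 0)"
    using has_derivative_compose[OF line, of "\<lambda>h. P h + \<gamma> * norm h powr q" "\<lambda>h. 0"] stat
    by (simp add: gderiv_def)
  then have 1: "((\<lambda>s. P h + \<gamma> * norm (h + s *\<^sub>R d) powr q) has_derivative (\<lambda>s. 0)) (at 0)"
    by (simp add: const)
  have "((\<lambda>x. norm x) has_derivative (\<lambda>k. k \<bullet> sgn h)) (at (h + 0 *\<^sub>R d))"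
    using has_derivative_norm[OF False] by simp
  from has_derivative_compose[OF line this]
  have "((\<lambda>s. norm (h + s *\<^sub>R d)) has_real_derivative d \<bullet> sgn h) (at 0)"
    by (simp add: has_field_derivative_def mult_commute_abs)
  then have 2: "((\<lambda>s. P h + \<gamma> * norm (h + s *\<^sub>R d) powr q) has_real_derivative
      \<gamma> * (q * norm h powr (q - 1) * (d \<bullet> sgn h))) (at 0)"
    using False by (auto intro!: derivative_eq_intros simp: powr_diff)
  have "\<gamma> * (q * norm h powr (q - 1) * (d \<bullet> sgn h)) = 0"
    using has_derivative_unique[OF 2[unfolded has_field_derivative_def] 1] by (metis mult.right_neutral)
  then show ?thesis using False assms by (simp add: sgn_div_norm)
qed simp

lemma sum_of_sets_subspace:
  assumes "subspace R" "finite I" "\<And>i. i \<in> I \<Longrightarrow> S i \<subseteq> R"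
  shows "(\<Sum>i\<in>I. S i) \<subseteq> R"
  using assms(2,3)
proof (induction I rule: finite_induct)
  case empty
  then show ?case using assms(1) by (simp add: set_zero subspace_0)
next
  case (insert i I)
  then show ?case using assms(1) by (auto simp: set_plus_def intro!: subspace_add)
qed

text \<open>
  The vanishing vectors \<open>b i\<close> for \<open>i \<ge> N\<close> spare a special treatment of the end of the chain.
\<close>

lemma bessel_inequality:
  fixes b :: "nat \<Rightarrow> 'a::euclidean_space"
  assumes orth: "\<And>i j. b i \<bullet> b j = (if i = j \<and> i < N then 1 else 0)"
  shows "(\<Sum>j<N. (b j \<bullet> h)\<^sup>2) \<le> (norm h)\<^sup>2"
proof -
  let ?P = "\<Sum>j<N. (b j \<bullet> h) *\<^sub>R b j"
  have PP: "?P \<bullet> ?P = (\<Sum>j<N. (b j \<bullet> h)\<^sup>2)"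
    by (simp add: inner_sum_left inner_sum_right orth power2_eq_square if_distrib cong: if_cong)
  have Ph: "?P \<bullet> h = (\<Sum>j<N. (b j \<bullet> h)\<^sup>2)"
    by (simp add: inner_sum_left power2_eq_square)
  have "0 \<le> (h - ?P) \<bullet> (h - ?P)" by simp
  also have "\<dots> = h \<bullet> h - (\<Sum>j<N. (b j \<bullet> h)\<^sup>2)"
    using PP Ph by (simp add: inner_diff_left inner_diff_right inner_commute)
  finally show ?thesis by (simp add: power2_norm_eq_inner)
qed

section \<open>The chain function and what a method can learn about it\<close>

text \<open>
  The part of the final bound that depends on the chain only: the norm of the \<open>p\<close>-linear forms and
  of their Hoelder remainder, the power \<open>p + \<nu> - 1\<close> of the distance from 0 to the minimizer, and the reciprocal
  of the lower bound on the gradient.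
\<close>

definition chain_constant :: "real \<Rightarrow> real \<Rightarrow> nat \<Rightarrow> real \<Rightarrow> real" where
  "chain_constant p \<nu> N \<rho> = sqrt (1 + \<rho>\<^sup>2) powr (p + \<nu> - 2) * (1 + \<rho>)\<^sup>2
     * sqrt (\<Sum>j<N. (\<Sum>i<N - j. \<rho> ^ i)\<^sup>2) powr (p + \<nu> - 1)
     * sqrt (\<Sum>j<N. inverse \<rho> ^ (2 * j))"

locale chain_function = ridge_kernel p \<nu> C g
  for p :: nat and \<nu> C :: real and g +
  fixes b :: "nat \<Rightarrow> 'a::euclidean_space" and N :: nat and \<rho> :: real
  assumes N_pos: "1 \<le> N" and \<rho>_pos: "0 < \<rho>" and \<rho>_le_1: "\<rho> \<le> 1"
    and orth: "b i \<bullet> b j = (if i = j \<and> i < N then 1 else 0)"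
begin

definition link :: "nat \<Rightarrow> 'a" where
  "link j = b j - \<rho> *\<^sub>R b (Suc j)"

definition chain :: "'a \<Rightarrow> real" where
  "chain x = (\<Sum>j<N. \<rho> ^ j * g 0 (link j \<bullet> x)) - b 0 \<bullet> x"

definition chain_grad :: "'a \<Rightarrow> 'a" where
  "chain_grad x = (\<Sum>j<N. (\<rho> ^ j * g 1 (link j \<bullet> x)) *\<^sub>R link j) - b 0"

definition minimizer :: 'a where
  "minimizer = (\<Sum>j<N. (\<Sum>i<N - j. \<rho> ^ i) *\<^sub>R b j)"

text \<open>
  Up to scaling the only vector in the span of the \<open>b j\<close> that is orthogonal to every link but the last.
\<close>

definition dual :: 'a where
  "dual = (\<Sum>j<N. inverse \<rho> ^ j *\<^sub>R b j)"

text \<open>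
  A subspace that contains the first \<open>k\<close> iterates of every method started at 0. The orthogonal
  complement of the chain is left free: \<open>chain\<close> does not vary along it, and the argument turns only on
  the coordinates that are still missing.
\<close>

definition reach :: "nat \<Rightarrow> 'a set" where
  "reach k = {x. \<forall>j\<ge>k. b j \<bullet> x = 0}"

lemma b_beyond: "N \<le> j \<Longrightarrow> b j = 0"
  using orth[of j j] by simp

lemma b_inner_sum: "b i \<bullet> (\<Sum>j<N. a j *\<^sub>R b j) = (if i < N then a i else 0)"
  by (simp add: inner_sum_right orth if_distrib cong: if_cong)

lemma norm_b_sum: "norm (\<Sum>j<N. a j *\<^sub>R b j) = sqrt (\<Sum>j<N. (a j)\<^sup>2)"
  by (simp add: norm_eq_sqrt_inner inner_sum_left b_inner_sum power2_eq_square)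

lemma norm_minimizer: "norm minimizer = sqrt (\<Sum>j<N. (\<Sum>i<N - j. \<rho> ^ i)\<^sup>2)"
  by (simp add: minimizer_def norm_b_sum)

lemma norm_dual: "norm dual = sqrt (\<Sum>j<N. inverse \<rho> ^ (2 * j))"
  by (simp add: dual_def norm_b_sum power_mult[symmetric] mult.commute)

lemma norm_link_le: "norm (link j) \<le> sqrt (1 + \<rho>\<^sup>2)"
proof -
  have "link j \<bullet> link j \<le> 1 + \<rho>\<^sup>2"
    by (simp add: link_def inner_diff_left inner_diff_right orth power2_eq_square)
  then show ?thesis by (simp add: norm_eq_sqrt_inner)
qed

lemma inner_link_le: "\<bar>link j \<bullet> h\<bar> \<le> sqrt (1 + \<rho>\<^sup>2) * norm h"
  using Cauchy_Schwarz_ineq2[of "link j" h] mult_right_mono[OF norm_link_le[of j], of "norm h"]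
  by simp

text \<open>
  The operator with rows \<open>link j\<close> is the identity minus \<open>\<rho>\<close> times a shift, hence of norm at most \<open>1 + \<rho>\<close>.
\<close>

lemma sum_link_squares: "(\<Sum>j<N. (link j \<bullet> h)\<^sup>2) \<le> ((1 + \<rho>) * norm h)\<^sup>2"
proof -
  let ?a = "\<lambda>j. (b j \<bullet> h)\<^sup>2"
  have "(link j \<bullet> h)\<^sup>2 \<le> (1 + \<rho>) * ?a j + \<rho> * (1 + \<rho>) * ?a (Suc j)" for j
  proof -
    have "0 \<le> \<rho> * (b j \<bullet> h + b (Suc j) \<bullet> h)\<^sup>2" using \<rho>_pos by simp
    then show ?thesis
      by (simp add: link_def inner_diff_left power2_eq_square algebra_simps)
  qed
  then have "(\<Sum>j<N. (link j \<bullet> h)\<^sup>2) \<le> (\<Sum>j<N. (1 + \<rho>) * ?a j + \<rho> * (1 + \<rho>) * ?a (Suc j))"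
    by (intro sum_mono) auto
  also have "\<dots> = (1 + \<rho>) * (\<Sum>j<N. ?a j) + \<rho> * (1 + \<rho>) * (\<Sum>j<N. ?a (Suc j))"
    by (simp add: sum.distrib sum_distrib_left)
  also have "(\<Sum>j<N. ?a (Suc j)) \<le> (\<Sum>j<N. ?a j)"
    using sum.lessThan_Suc_shift[of ?a N] b_beyond[of N] by simp
  also have "(1 + \<rho>) * (\<Sum>j<N. ?a j) + \<rho> * (1 + \<rho>) * (\<Sum>j<N. ?a j) = (1 + \<rho>)\<^sup>2 * (\<Sum>j<N. ?a j)"
    by (simp add: power2_eq_square algebra_simps)
  also have "\<dots> \<le> (1 + \<rho>)\<^sup>2 * (norm h)\<^sup>2"
    using bessel_inequality[OF orth] by (intro mult_left_mono) auto
  finally show ?thesis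
    using \<rho>_pos by (simp add: power_mult_distrib)
qed

lemma sum_link_products: "(\<Sum>j<N. \<bar>link j \<bullet> h\<bar> * \<bar>link j \<bullet> k\<bar>) \<le> (1 + \<rho>)\<^sup>2 * norm h * norm k"
proof -
  have *: "L2_set (\<lambda>j. link j \<bullet> h) {..<N} \<le> (1 + \<rho>) * norm h" for h
    unfolding L2_set_def using sum_link_squares[of h] \<rho>_pos
    by (intro real_le_lsqrt) (auto simp: sum_nonneg)
  have "(\<Sum>j<N. \<bar>link j \<bullet> h\<bar> * \<bar>link j \<bullet> k\<bar>) \<le> L2_set (\<lambda>j. link j \<bullet> h) {..<N} * L2_set (\<lambda>j. link j \<bullet> k) {..<N}"
    by (rule L2_set_mult_ineq)
  also have "\<dots> \<le> ((1 + \<rho>) * norm h) * ((1 + \<rho>) * norm k)"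
    using * \<rho>_pos by (intro mult_mono) (auto simp: L2_set_nonneg)
  finally show ?thesis by (simp add: power2_eq_square mult_ac)
qed

lemma prod_list_link_le:
  assumes "\<forall>h\<in>set hs. norm h \<le> 1"
  shows "\<bar>\<Prod>h\<leftarrow>hs. link j \<bullet> h\<bar> \<le> sqrt (1 + \<rho>\<^sup>2) ^ length hs"
  using assms
proof (induction hs)
  case (Cons h hs)
  have "\<bar>link j \<bullet> h\<bar> \<le> sqrt (1 + \<rho>\<^sup>2)"
    using inner_link_le[of j h] Cons.prems mult_left_mono[of "norm h" 1 "sqrt (1 + \<rho>\<^sup>2)"] by simp
  then show ?case
    using Cons by (auto simp: abs_mult intro!: mult_mono)
qed simp

text \<open>
  Two of the \<open>p + \<nu>\<close> linear factors suffice to sum over \<open>j\<close>, at the cost of the operator norm \<open>1 + \<rho>\<close>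
  for each. All the others are bounded by the norm of a link, at most \<open>sqrt (1 + \<rho>\<^sup>2)\<close>, which is smaller. For
  \<open>p = 1\<close> the second factor is the Hoelder increment, as then \<open>\<nu> = 1\<close>.
\<close>

lemma sum_link_forms:
  assumes len: "length hs = p" and unit: "\<forall>h\<in>set hs. norm h \<le> 1"
  shows "(\<Sum>j<N. \<bar>link j \<bullet> z\<bar> powr \<nu> * \<bar>\<Prod>h\<leftarrow>hs. link j \<bullet> h\<bar>)
    \<le> sqrt (1 + \<rho>\<^sup>2) powr (real p + \<nu> - 2) * (1 + \<rho>)\<^sup>2 * norm z powr \<nu>"
proof -
  let ?M = "sqrt (1 + \<rho>\<^sup>2)"
  have M: "0 < ?M" by (simp add: add_pos_nonneg)
  obtain h1 hs' where hs: "hs = h1 # hs'" using len p_pos by (cases hs) auto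
  show ?thesis
  proof (cases hs')
    case Nil
    then have p: "p = 1" using len hs by simp
    then have \<nu>: "\<nu> = 1" using \<nu>_le_1 order_ge_2 by simp
    have "(\<Sum>j<N. \<bar>link j \<bullet> z\<bar> * \<bar>link j \<bullet> h1\<bar>) \<le> (1 + \<rho>)\<^sup>2 * norm z * norm h1"
      by (rule sum_link_products)
    also have "\<dots> \<le> (1 + \<rho>)\<^sup>2 * norm z * 1"
      using unit hs by (intro mult_left_mono) auto
    finally show ?thesis using hs Nil \<nu> p M by simp
  next
    case (Cons h2 hs'')
    have p: "p = length hs'' + 2" using len hs Cons by simp
    have "(\<Sum>j<N. \<bar>link j \<bullet> z\<bar> powr \<nu> * \<bar>\<Prod>h\<leftarrow>hs. link j \<bullet> h\<bar>)
        \<le> (\<Sum>j<N. (?M * norm z) powr \<nu> * (\<bar>link j \<bullet> h1\<bar> * \<bar>link j \<bullet> h2\<bar> * ?M ^ (p - 2)))"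
    proof (intro sum_mono mult_mono)
      fix j
      show "\<bar>link j \<bullet> z\<bar> powr \<nu> \<le> (?M * norm z) powr \<nu>"
        using inner_link_le \<nu>_nonneg by (intro powr_mono2) auto
      have "\<bar>\<Prod>h\<leftarrow>hs. link j \<bullet> h\<bar> = \<bar>link j \<bullet> h1\<bar> * \<bar>link j \<bullet> h2\<bar> * \<bar>\<Prod>h\<leftarrow>hs''. link j \<bullet> h\<bar>"
        by (simp add: hs Cons abs_mult mult_ac)
      also have "\<dots> \<le> \<bar>link j \<bullet> h1\<bar> * \<bar>link j \<bullet> h2\<bar> * ?M ^ (p - 2)"
        using prod_list_link_le[of hs'' j] unit hs Cons p by (intro mult_left_mono) auto
      finally show "\<bar>\<Prod>h\<leftarrow>hs. link j \<bullet> h\<bar> \<le> \<bar>link j \<bullet> h1\<bar> * \<bar>link j \<bullet> h2\<bar> * ?M ^ (p - 2)" .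
    qed auto
    also have "\<dots> = (?M * norm z) powr \<nu> * ?M ^ (p - 2) * (\<Sum>j<N. \<bar>link j \<bullet> h1\<bar> * \<bar>link j \<bullet> h2\<bar>)"
      by (simp add: sum_distrib_left mult_ac)
    also have "\<dots> \<le> (?M * norm z) powr \<nu> * ?M ^ (p - 2) * ((1 + \<rho>)\<^sup>2 * norm h1 * norm h2)"
      using M by (intro mult_left_mono sum_link_products) auto
    also have "\<dots> \<le> (?M * norm z) powr \<nu> * ?M ^ (p - 2) * ((1 + \<rho>)\<^sup>2 * 1 * 1)"
      using M unit hs Cons by (intro mult_left_mono mult_mono) auto
    also have "\<dots> = ?M powr (real p + \<nu> - 2) * (1 + \<rho>)\<^sup>2 * norm z powr \<nu>"
    proof -
      have "?M powr (real p + \<nu> - 2) = ?M powr (real (p - 2) + \<nu>)" using p by simp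
      also have "\<dots> = ?M ^ (p - 2) * ?M powr \<nu>"
        using M by (simp only: powr_add powr_realpow)
      finally show ?thesis by (simp add: powr_mult mult_ac)
    qed
    finally show ?thesis .
  qed
qed

lemma nth_deriv_chain:
  assumes "length hs \<le> p"
  shows "nth_deriv chain hs = (\<lambda>x. (\<Sum>j<N. \<rho> ^ j * g (length hs) (link j \<bullet> x) * (\<Prod>h\<leftarrow>hs. link j \<bullet> h))
      - (case hs of [] \<Rightarrow> b 0 \<bullet> x | [h] \<Rightarrow> b 0 \<bullet> h | _ \<Rightarrow> 0))"
  using nth_deriv_ridge_sum(1)[where p = p and g = g and N = N and w = "\<lambda>j. \<rho> ^ j" and v = link and c = "b 0" and hs = hs, OF deriv assms]
  by (simp add: chain_def[abs_def])

lemma nth_deriv_chain_replicate: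
  assumes "1 \<le> i" "i \<le> p"
  shows "nth_deriv chain (replicate i h) x
    = (\<Sum>j<N. \<rho> ^ j * (g i (link j \<bullet> x) * (link j \<bullet> h) ^ i)) - (if i = 1 then b 0 \<bullet> h else 0)"
proof -
  have "(case replicate i h of [] \<Rightarrow> b 0 \<bullet> x | [h] \<Rightarrow> b 0 \<bullet> h | _ \<Rightarrow> 0) = (if i = 1 then b 0 \<bullet> h else 0)"
    using assms(1) by (cases i; cases "i - 1") auto
  then show ?thesis
    using nth_deriv_chain[of "replicate i h"] assms(2) by (simp add: mult.assoc)
qed

lemma times_differentiable_chain: "times_differentiable p chain"
proof -
  have "nth_deriv chain hs differentiable (at x)" if "length hs < p" for hs x
    using nth_deriv_ridge_sum(2)[where p = p and g = g and N = N and w = "\<lambda>j. \<rho> ^ j" and v = link and c = "b 0" and hs = hs, OF deriv that]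
    unfolding nth_deriv_chain[OF less_imp_le[OF that]] differentiable_def by blast
  then show ?thesis by (simp add: times_differentiable_def)
qed

lemma gderiv_chain: "GDERIV chain x :> chain_grad x"
proof -
  have "chain differentiable (at x)"
    using times_differentiable_chain p_pos
    unfolding times_differentiable_def by (metis One_nat_def Suc_le_eq list.size(3) nth_deriv.simps(1))
  then have "(chain has_derivative (\<lambda>h. nth_deriv chain [h] x)) (at x)"
    by (simp add: frechet_derivative_works)
  moreover have "nth_deriv chain [h] x = h \<bullet> chain_grad x" for h
    using p_pos by (simp add: nth_deriv_chain chain_grad_def inner_diff_right inner_sum_right inner_commute del: nth_deriv.simps)
  ultimately show ?thesis by (simp add: gderiv_def del: nth_deriv.simps)
qed

text \<open>
  The linear term drops out of differences of derivatives, and the weights \<open>\<rho> ^ j\<close> are at most 1.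
\<close>

lemma holder_const_chain:
  "holder_const p \<nu> chain \<le> ennreal (C * (sqrt (1 + \<rho>\<^sup>2) powr (real p + \<nu> - 2) * (1 + \<rho>)\<^sup>2))"
  (is "_ \<le> ennreal (C * ?B)")
proof -
  have "form_norm p (\<lambda>hs. nth_deriv chain hs x - nth_deriv chain hs y) \<le> C * ?B * norm (x - y) powr \<nu>" for x y
    unfolding form_norm_def
  proof (rule cSUP_least)
    have "replicate p 0 \<in> {hs :: 'a list. length hs = p \<and> (\<forall>h\<in>set hs. norm h \<le> 1)}" by simp
    then show "{hs :: 'a list. length hs = p \<and> (\<forall>h\<in>set hs. norm h \<le> 1)} \<noteq> {}" by blast
    fix hs :: "'a list" assume "hs \<in> {hs. length hs = p \<and> (\<forall>h\<in>set hs. norm h \<le> 1)}"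
    then have len: "length hs = p" and unit: "\<forall>h\<in>set hs. norm h \<le> 1" by auto
    have "nth_deriv chain hs x - nth_deriv chain hs y
        = (\<Sum>j<N. \<rho> ^ j * ((g p (link j \<bullet> x) - g p (link j \<bullet> y)) * (\<Prod>h\<leftarrow>hs. link j \<bullet> h)))"
      using len p_pos by (cases hs) (simp_all add: nth_deriv_chain sum_subtractf algebra_simps del: nth_deriv.simps split: list.split)
    also have "\<bar>\<dots>\<bar> \<le> (\<Sum>j<N. \<bar>\<rho> ^ j * ((g p (link j \<bullet> x) - g p (link j \<bullet> y)) * (\<Prod>h\<leftarrow>hs. link j \<bullet> h))\<bar>)"
      by (rule sum_abs)
    also have "\<dots> \<le> (\<Sum>j<N. 1 * ((C * \<bar>link j \<bullet> (x - y)\<bar> powr \<nu>) * \<bar>\<Prod>h\<leftarrow>hs. link j \<bullet> h\<bar>))"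
      unfolding abs_mult
    proof (intro sum_mono mult_mono)
      fix j
      show "\<bar>g p (link j \<bullet> x) - g p (link j \<bullet> y)\<bar> \<le> C * \<bar>link j \<bullet> (x - y)\<bar> powr \<nu>"
        using holder by (simp add: inner_diff_right)
    qed (use \<rho>_pos \<rho>_le_1 C_nonneg in \<open>auto intro: power_le_one\<close>)
    also have "\<dots> = C * (\<Sum>j<N. \<bar>link j \<bullet> (x - y)\<bar> powr \<nu> * \<bar>\<Prod>h\<leftarrow>hs. link j \<bullet> h\<bar>)"
      by (simp add: sum_distrib_left mult_ac)
    also have "\<dots> \<le> C * (?B * norm (x - y) powr \<nu>)"
      using C_nonneg by (intro mult_left_mono sum_link_forms len unit)
    finally show "\<bar>nth_deriv chain hs x - nth_deriv chain hs y\<bar> \<le> C * ?B * norm (x - y) powr \<nu>"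
      by (simp add: mult_ac)
  qed
  then have "form_norm p (\<lambda>hs. nth_deriv chain hs x - nth_deriv chain hs y) / norm (x - y) powr \<nu> \<le> C * ?B"
    if "x \<noteq> y" for x y
    using that by (simp add: divide_le_eq)
  then show ?thesis
    unfolding holder_const_def by (intro SUP_least) (auto intro!: ennreal_leI)
qed

lemma convex_g: "convex_on UNIV (g 0)"
  using deriv[of 0] p_pos slope_mono by (intro convex_on_realI[of _ _ "g 1"]) auto

lemma convex_chain: "convex_on UNIV chain"
proof (rule convex_onI)
  fix t :: real and x y :: 'a
  assume t: "0 < t" "t < 1"
  have "(\<Sum>j<N. \<rho> ^ j * g 0 (link j \<bullet> ((1 - t) *\<^sub>R x + t *\<^sub>R y)))
      \<le> (\<Sum>j<N. \<rho> ^ j * ((1 - t) * g 0 (link j \<bullet> x) + t * g 0 (link j \<bullet> y)))"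
    using t \<rho>_pos convex_onD[OF convex_g, of t]
    by (intro sum_mono mult_left_mono) (auto simp: inner_add_right)
  also have "\<dots> = (1 - t) * (\<Sum>j<N. \<rho> ^ j * g 0 (link j \<bullet> x)) + t * (\<Sum>j<N. \<rho> ^ j * g 0 (link j \<bullet> y))"
    by (simp add: sum_distrib_left algebra_simps flip: sum.distrib)
  finally show "chain ((1 - t) *\<^sub>R x + t *\<^sub>R y) \<le> (1 - t) * chain x + t * chain y"
    unfolding chain_def by (simp add: inner_add_right algebra_simps)
qed simp

lemma sum_links: "(\<Sum>j<N. \<rho> ^ j *\<^sub>R link j) = b 0"
proof -
  have "(\<Sum>j<n. \<rho> ^ j *\<^sub>R link j) = b 0 - \<rho> ^ n *\<^sub>R b n" for n
    by (induction n) (auto simp: link_def algebra_simps)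
  then show ?thesis using b_beyond[of N] by simp
qed

lemma link_minimizer:
  assumes "j < N"
  shows "link j \<bullet> minimizer = 1"
proof -
  have "N - j = Suc (N - Suc j)" using assms by simp
  then have "(\<Sum>i<N - j. \<rho> ^ i) = 1 + \<rho> * (\<Sum>i<N - Suc j. \<rho> ^ i)"
    by (simp only: sum.lessThan_Suc_shift) (simp add: sum_distrib_left)
  then show ?thesis
    using assms by (auto simp: link_def inner_diff_left minimizer_def b_inner_sum not_less)
qed

text \<open>
  Bounding each summand from below by its tangent at 1, where the slope is 1, leaves
  \<open>(\<Sum>j<N. \<rho> ^ j * (link j \<bullet> x)) - b 0 \<bullet> x\<close> as the only part that depends on \<open>x\<close>; it is 0 by \<open>sum_links\<close>.
  At the minimizer all tangents touch at once.
\<close>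

lemma global_minimizer_chain: "global_minimizer chain minimizer"
  unfolding global_minimizer_def
proof
  fix x
  have b0: "b 0 \<bullet> x = (\<Sum>j<N. \<rho> ^ j * (link j \<bullet> x))" for x
    by (simp add: inner_sum_left flip: sum_links)
  have tangent: "g 0 1 + (s - 1) \<le> g 0 s" for s
    using convex_on_imp_above_tangent[OF convex_g, of 1 s "g 1 1"] deriv[of 0 1] p_pos slope_1 by simp
  have "chain minimizer = (\<Sum>j<N. \<rho> ^ j * (g 0 1 - 1))"
    using link_minimizer by (simp add: chain_def b0 right_diff_distrib sum_subtractf)
  also have "\<dots> \<le> (\<Sum>j<N. \<rho> ^ j * (g 0 (link j \<bullet> x) - link j \<bullet> x))"
  proof (intro sum_mono mult_left_mono)
    show "g 0 1 - 1 \<le> g 0 (link j \<bullet> x) - link j \<bullet> x" for j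
      using tangent[of "link j \<bullet> x"] by simp
  qed (use \<rho>_pos in simp)
  also have "\<dots> = chain x"
    by (simp add: chain_def b0 right_diff_distrib sum_subtractf)
  finally show "chain minimizer \<le> chain x" .
qed

lemma chain_problem_class: "chain \<in> problem_class p \<nu>"
  using convex_chain times_differentiable_chain global_minimizer_chain holder_const_chain
  by (auto simp: problem_class_def intro: le_less_trans)

lemma dual_link: "j < N \<Longrightarrow> dual \<bullet> link j = (if Suc j = N then inverse \<rho> ^ j else 0)"
  using \<rho>_pos
  by (auto simp: link_def inner_diff_right dual_def b_inner_sum inner_commute[of "sum _ _"])

text \<open>
  Pairing the gradient with \<open>dual\<close> annihilates every link but the last, whose slope \<open>g 1 0\<close> vanishes at
  such a point. Only the constant part \<open>- b 0\<close> remains.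
\<close>

lemma gradient_lower_bound:
  assumes "b (N - 1) \<bullet> x = 0"
  shows "1 \<le> norm (gradient chain x) * norm dual"
proof -
  have last: "link (N - 1) \<bullet> x = 0"
    using assms N_pos b_beyond[of N] by (simp add: link_def)
  have "dual \<bullet> chain_grad x = (\<Sum>j<N. \<rho> ^ j * g 1 (link j \<bullet> x) * (dual \<bullet> link j)) - dual \<bullet> b 0"
    by (simp add: chain_grad_def inner_diff_right inner_sum_right)
  also have "(\<Sum>j<N. \<rho> ^ j * g 1 (link j \<bullet> x) * (dual \<bullet> link j)) = 0"
  proof (intro sum.neutral ballI)
    fix j assume "j \<in> {..<N}"
    then show "\<rho> ^ j * g 1 (link j \<bullet> x) * (dual \<bullet> link j) = 0"
      using last flat[of 1] p_pos by (cases "Suc j = N") (auto simp: dual_link)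
  qed
  also have "dual \<bullet> b 0 = 1"
    using N_pos by (simp add: dual_def b_inner_sum inner_commute[of "sum _ _"])
  finally have "\<bar>dual \<bullet> chain_grad x\<bar> = 1" by simp
  then show ?thesis
    using Cauchy_Schwarz_ineq2[of dual "chain_grad x"] gradient_eq[OF gderiv_chain[of x]]
    by (simp add: mult.commute)
qed

lemma subspace_reach: "subspace (reach k)"
  by (auto simp: reach_def subspace_def inner_add_right)

lemma reach_mono: "i \<le> k \<Longrightarrow> reach i \<subseteq> reach k"
  by (auto simp: reach_def)

text \<open>
  At \<open>x \<in> reach k\<close> only links with index below \<open>k\<close> have nonzero derivatives, and these are orthogonal
  to \<open>b j\<close> for \<open>j > k\<close>. The polynomial part of a model is thus constant along \<open>b j\<close>, and
  a stationary point has no component there.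
\<close>

lemma step_space_reach:
  assumes x: "x \<in> reach k"
  shows "step_space p chain x \<subseteq> reach (Suc k)"
  unfolding step_space_def
proof (rule span_minimal[OF Union_least subspace_reach], safe)
  fix a \<gamma> q and h :: 'a
  assume "h \<in> stationary_points p chain x a \<gamma> q" and \<gamma>: "0 < \<gamma>" and q: "1 < q"
  then have stat: "GDERIV (model p chain x a \<gamma> q) h :> 0"
    by (simp add: stationary_points_def)
  have "b j \<bullet> h = 0" if j: "Suc k \<le> j" for j
  proof (rule orthogonal_if_stationary_along[OF stat[unfolded model_def[abs_def]] _ \<gamma> q])
    fix s
    have "nth_deriv chain (replicate i (h + s *\<^sub>R b j)) x = nth_deriv chain (replicate i h) x"
      if i: "i \<in> {1..p}" for i
    proof -
      have "g i (link l \<bullet> x) * (link l \<bullet> (h + s *\<^sub>R b j)) ^ i = g i (link l \<bullet> x) * (link l \<bullet> h) ^ i" for l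
      proof (cases "l < k")
        case True
        then have "link l \<bullet> b j = 0" using j by (simp add: link_def inner_diff_left orth)
        then show ?thesis by (simp add: inner_add_right)
      next
        case False
        then have "link l \<bullet> x = 0" using x by (simp add: link_def inner_diff_left reach_def)
        then show ?thesis using i flat by simp
      qed
      note eq = this
      have "b 0 \<bullet> (h + s *\<^sub>R b j) = b 0 \<bullet> h"
        using j by (simp add: inner_add_right orth)
      then show ?thesis
        using i by (simp only: nth_deriv_chain_replicate eq atLeastAtMost_iff)
    qed
    then show "(\<Sum>i=1..p. a i * nth_deriv chain (replicate i (h + s *\<^sub>R b j)) x)
        = (\<Sum>i=1..p. a i * nth_deriv chain (replicate i h) x)"
      by (intro sum.cong) auto
  qed
  then show "h \<in> reach (Suc k)" by (auto simp: reach_def)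
qed

lemma iterates_reach:
  assumes "tensor_method p \<nu> M"
  shows "M chain 0 k \<in> reach k"
proof (induction k rule: less_induct)
  case (less k)
  show ?case
  proof (cases k)
    case 0
    then show ?thesis
      using assms chain_problem_class by (auto simp: tensor_method_def reach_def)
  next
    case (Suc n)
    have "M chain 0 k \<in> 0 +o (\<Sum>i=0..n. step_space p chain (M chain 0 i))"
      using assms chain_problem_class unfolding tensor_method_def Suc by blast
    then have "M chain 0 k \<in> (\<Sum>i=0..n. step_space p chain (M chain 0 i))" by simp
    moreover have "(\<Sum>i=0..n. step_space p chain (M chain 0 i)) \<subseteq> reach k"
    proof (rule sum_of_sets_subspace[OF subspace_reach])
      fix i assume i: "i \<in> {0..n}"
      then have "step_space p chain (M chain 0 i) \<subseteq> reach (Suc i)"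
        using less Suc by (intro step_space_reach) auto
      also have "\<dots> \<subseteq> reach k" using i Suc by (intro reach_mono) auto
      finally show "step_space p chain (M chain 0 i) \<subseteq> reach k" .
    qed simp
    ultimately show ?thesis by blast
  qed
qed

text \<open>
  The rate at time \<open>N\<close> concerns the iterates up to \<open>N - 1\<close>, which all miss the last coordinate
  \<open>b (N - 1)\<close>. Comparing the two bounds on their smallest gradient isolates \<open>\<kappa>\<close>.
\<close>

theorem rate_bound:
  fixes M :: "'a opt_method"
  assumes M: "tensor_method p \<nu> M" and N: "2 \<le> N" and \<kappa>: "0 < \<kappa>"
    and rate: "\<And>f x0 xs. f \<in> problem_class p \<nu> \<Longrightarrow> global_minimizer f xs \<Longrightarrow>
           Min ((\<lambda>k. norm (gradient f (M f x0 k))) ` {1..N - 1})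
             \<le> enn2real (holder_const p \<nu> f) * norm (x0 - xs) powr (real p + \<nu> - 1) / \<kappa>"
  shows "\<kappa> \<le> C * chain_constant p \<nu> N \<rho>"
proof -
  let ?r = "norm minimizer powr (real p + \<nu> - 1)"
  let ?B = "sqrt (1 + \<rho>\<^sup>2) powr (real p + \<nu> - 2) * (1 + \<rho>)\<^sup>2"
  let ?S = "(\<lambda>k. norm (gradient chain (M chain 0 k))) ` {1..N - 1}"
  have H: "enn2real (holder_const p \<nu> chain) \<le> C * ?B"
    using holder_const_chain C_nonneg by (intro enn2real_leI) auto
  have "Min ?S \<in> ?S" using N by (intro Min_in) auto
  then obtain k where k: "k \<le> N - 1" and Min: "Min ?S = norm (gradient chain (M chain 0 k))" by auto
  have "b (N - 1) \<bullet> M chain 0 k = 0"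
    using iterates_reach[OF M, of k] k by (simp add: reach_def)
  then have "1 \<le> Min ?S * norm dual" unfolding Min by (rule gradient_lower_bound)
  also have "\<dots> \<le> enn2real (holder_const p \<nu> chain) * ?r / \<kappa> * norm dual"
    using rate[OF chain_problem_class global_minimizer_chain, of 0] by (intro mult_right_mono) auto
  also have "\<dots> \<le> C * ?B * ?r / \<kappa> * norm dual"
    using H \<kappa> by (intro mult_right_mono divide_right_mono) auto
  finally have "\<kappa> \<le> C * ?B * ?r * norm dual" using \<kappa> by (simp add: field_simps)
  then show ?thesis
    by (simp add: chain_constant_def norm_minimizer norm_dual mult_ac)
qed

end

section \<open>The constant of the bound\<close>

lemma sum_squares_reversed:
  "(\<Sum>j<N. (real (N - j))\<^sup>2) = real N * (real N + 1) * (2 * real N + 1) / 6"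
proof -
  have "(\<Sum>j<N. (real (N - j))\<^sup>2) = (\<Sum>j<N. (real (Suc j))\<^sup>2)"
    by (subst sum.nat_diff_reindex[symmetric]) (auto intro!: sum.cong)
  also have "\<dots> = real N * (real N + 1) * (2 * real N + 1) / 6"
    by (induction N) (auto simp: field_simps power2_eq_square)
  finally show ?thesis .
qed

text \<open>
  Without damping, the coordinates of the minimizer are \<open>t, t - 1, \<dots>, 1\<close>, and the asserted powers of
  \<open>t + 1\<close> and 3 appear directly. What remains is the comparison of \<open>2\<^bsup>p/2\<^esup>\<close> with \<open>p + \<nu>\<close>.
\<close>

lemma balanced_chain_constant:
  assumes "1 \<le> p" "p \<le> 4" "0 \<le> \<nu>" "2 \<le> real p + \<nu>"
  defines "m \<equiv> real p + \<nu> - 1"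
  shows "chain_constant p \<nu> t 1 \<le> 2 powr ((2 + \<nu>) / 2) * (m + 1) * sqrt (real (t + 1))
      * sqrt (real (t + 1) ^ 3 / 3) powr m"
proof -
  have p: "2 powr (real p / 2) \<le> m + 1"
  proof -
    have s2: "sqrt 2 \<le> 3 / 2" by (rule real_le_lsqrt) (auto simp: power2_eq_square)
    consider "p = 1" | "p = 2" | "p = 3" | "p = 4" using assms by linarith
    then show ?thesis
    proof cases
      case 1 then show ?thesis using assms s2 by (simp add: powr_half_sqrt)
    next
      case 2 then show ?thesis using assms by simp
    next
      case 3
      have "(2::real) powr (3 / 2) = 2 powr (1 + 1 / 2)" by simp
      also have "\<dots> = 2 * sqrt 2" by (simp only: powr_add powr_half_sqrt) simp
      finally show ?thesis using 3 assms s2 by simp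
    next
      case 4 then show ?thesis using assms by simp
    qed
  qed
  have "sqrt 2 powr (real p + \<nu> - 2) * 4 = 2 powr ((real p + \<nu> - 2) / 2 + 2)"
    by (simp add: powr_add powr_powr flip: powr_half_sqrt)
  also have "(real p + \<nu> - 2) / 2 + 2 = (2 + \<nu>) / 2 + real p / 2" by (simp add: field_simps)
  also have "2 powr ((2 + \<nu>) / 2 + real p / 2) \<le> 2 powr ((2 + \<nu>) / 2) * (m + 1)"
    using p by (simp add: powr_add)
  finally have B: "sqrt 2 powr (real p + \<nu> - 2) * 4 \<le> 2 powr ((2 + \<nu>) / 2) * (m + 1)" .
  have "(\<Sum>j<t. (\<Sum>i<t - j. 1 ^ i :: real)\<^sup>2) = real t * (real t + 1) * (2 * real t + 1) / 6"
    using sum_squares_reversed[of t] by simp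
  also have "\<dots> \<le> real (t + 1) ^ 3 / 3"
    by (simp add: power3_eq_cube field_simps)
  finally have X: "sqrt (\<Sum>j<t. (\<Sum>i<t - j. 1 ^ i :: real)\<^sup>2) powr m \<le> sqrt (real (t + 1) ^ 3 / 3) powr m"
    using assms by (intro powr_mono2 real_sqrt_le_mono real_sqrt_ge_zero sum_nonneg) auto
  have U: "sqrt (\<Sum>j<t. inverse 1 ^ (2 * j)) \<le> sqrt (real (t + 1))" by simp
  have "chain_constant p \<nu> t 1 = sqrt 2 powr (real p + \<nu> - 2) * 4
      * sqrt (\<Sum>j<t. (\<Sum>i<t - j. 1 ^ i :: real)\<^sup>2) powr m * sqrt (\<Sum>j<t. inverse 1 ^ (2 * j))"
    by (simp add: chain_constant_def m_def)
  also have "\<dots> \<le> 2 powr ((2 + \<nu>) / 2) * (m + 1) * sqrt (real (t + 1) ^ 3 / 3) powr m * sqrt (real (t + 1))"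
    using assms by (intro mult_mono B X U) (auto intro!: sum_nonneg)
  finally show ?thesis by (simp add: mult_ac)
qed

text \<open>
  Here \<open>\<rho>\<^sup>t\<close> stays below \<open>1 / 3\<close>, so that a coordinate \<open>(1 - \<rho>\<^sup>r) / (1 - \<rho>)\<close> of the minimizer stays below
  \<open>(t + 1) / 2\<close>. Its squared norm \<open>X\<close> is at most \<open>7 / 48\<close> of \<open>(t + 1)\<^sup>3\<close>, less than half of the \<open>1 / 3\<close>
  to compare with, which compensates the factor 2 that the squared norm of a link contributes,
  with a rest of \<open>7 / 8\<close>. The squared norm \<open>U\<close> of the dual vector grows by a factor of at most 21, mainly
  \<open>e\<^sup>4 / 4\<close>, and is absorbed by \<open>p + \<nu> \<ge> 5\<close> and two factors \<open>7 / 8\<close>.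
\<close>

lemma damped_chain_constant:
  assumes "5 \<le> p" "0 \<le> \<nu>" "2 \<le> t"
  defines "m \<equiv> real p + \<nu> - 1" and "\<rho> \<equiv> (real t - 1) / (real t + 1)"
  shows "chain_constant p \<nu> t \<rho> \<le> 2 powr ((2 + \<nu>) / 2) * (m + 1) * sqrt (real (t + 1))
      * sqrt (real (t + 1) ^ 3 / 3) powr m"
proof -
  let ?\<tau> = "real t + 1"
  define X where "X = (\<Sum>j<t. (\<Sum>i<t - j. \<rho> ^ i)\<^sup>2)"
  define U where "U = (\<Sum>j<t. inverse \<rho> ^ (2 * j))"
  have m: "4 \<le> m" using assms by (simp add: m_def)
  have \<rho>: "0 < \<rho>" "\<rho> < 1" using assms by (auto simp: \<rho>_def)
  have \<rho>': "1 - \<rho> = 2 / ?\<tau>" by (simp add: \<rho>_def field_simps)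
  have "1 + \<rho> = 2 * real t / ?\<tau>" by (simp add: \<rho>_def field_simps)
  then have "(1 - \<rho>) * (1 + \<rho>) = 4 * real t / ?\<tau>\<^sup>2"
    by (simp add: \<rho>' power2_eq_square)
  then have gap: "1 - \<rho>\<^sup>2 = 4 * real t / ?\<tau>\<^sup>2"
    by (simp add: power2_eq_square algebra_simps)
  have inv: "inverse \<rho> = 1 + 2 / (real t - 1)"
    using assms by (simp add: \<rho>_def field_simps)
  have decay: "\<rho> ^ t \<le> 1 / 3"
  proof -
    have "3 \<le> 1 + real t * (2 / (real t - 1))" using assms by (simp add: field_simps)
    also have "\<dots> \<le> inverse \<rho> ^ t"
    proof -
      have "0 \<le> 2 / (real t - 1)" using assms(3) by simp
      then show ?thesis unfolding inv by (intro Bernoulli_inequality) linarith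
    qed
    finally have "3 \<le> 1 / \<rho> ^ t" by (simp add: power_inverse flip: inverse_eq_divide)
    moreover have "0 < \<rho> ^ t" using \<rho>(1) by simp
    ultimately show ?thesis by (simp add: pos_le_divide_eq)
  qed
  have X: "X \<le> 7 * ?\<tau> ^ 3 / 48"
  proof -
    have "X = (\<Sum>j<t. ((1 - \<rho> ^ (t - j)) / (1 - \<rho>))\<^sup>2)"
      unfolding X_def using \<rho> by (simp add: sum_gp_strict)
    also have "\<dots> = (\<Sum>j<t. ((1 - \<rho> ^ Suc j) / (1 - \<rho>))\<^sup>2)"
      by (subst sum.nat_diff_reindex[symmetric]) (auto intro!: sum.cong)
    also have "\<dots> = (\<Sum>j<t. 1 - 2 * \<rho> * \<rho> ^ j + \<rho>\<^sup>2 * (\<rho>\<^sup>2) ^ j) / (1 - \<rho>)\<^sup>2"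
      by (simp add: power_divide power2_eq_square algebra_simps power_mult_distrib flip: sum_divide_distrib)
    also have "(\<Sum>j<t. 1 - 2 * \<rho> * \<rho> ^ j + \<rho>\<^sup>2 * (\<rho>\<^sup>2) ^ j)
        = t - 2 * \<rho> * ((1 - \<rho> ^ t) / (1 - \<rho>)) + \<rho>\<^sup>2 * ((1 - (\<rho>\<^sup>2) ^ t) / (1 - \<rho>\<^sup>2))"
      using \<rho> power_less_one_iff[of \<rho> 2]
      by (simp add: sum.distrib sum_subtractf sum_gp_strict flip: sum_distrib_left)
    \<comment> \<open>The remaining geometric series may be extended to infinity.\<close>
    also have "\<rho>\<^sup>2 * ((1 - (\<rho>\<^sup>2) ^ t) / (1 - \<rho>\<^sup>2)) \<le> \<rho>\<^sup>2 * (1 / (1 - \<rho>\<^sup>2))"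
      using \<rho> power_less_one_iff[of \<rho> 2] by (intro mult_left_mono divide_right_mono) auto
    also have "\<rho>\<^sup>2 * (1 / (1 - \<rho>\<^sup>2)) = (real t - 1) * ((real t - 1) / (4 * real t))"
      unfolding gap by (simp add: \<rho>_def power_divide) (simp add: power2_eq_square)
    also have "(real t - 1) * ((real t - 1) / (4 * real t)) \<le> (real t - 1) * (1 / 4)"
      using assms by (intro mult_left_mono) (auto simp: field_simps)
    also have "2 * \<rho> * ((1 - \<rho> ^ t) / (1 - \<rho>)) = (real t - 1) * (1 - \<rho> ^ t)"
      unfolding \<rho>' by (simp add: \<rho>_def)
    also have "real t - (real t - 1) * (1 - \<rho> ^ t) + (real t - 1) * (1 / 4)
        = 1 + (real t - 1) * \<rho> ^ t + (real t - 1) * (1 / 4)" by (simp add: algebra_simps)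
    also have "\<dots> \<le> 1 + (real t - 1) * (1 / 3) + (real t - 1) * (1 / 4)"
      using decay assms by (intro add_mono mult_left_mono) auto
    also have "\<dots> \<le> 7 / 12 * ?\<tau>" by argo
    finally have "X \<le> 7 / 12 * ?\<tau> / (1 - \<rho>)\<^sup>2" by (simp add: divide_right_mono)
    also have "\<dots> = 7 * ?\<tau> ^ 3 / 48"
      unfolding \<rho>' by (simp add: power_divide power2_eq_square power3_eq_cube)
    finally show ?thesis .
  qed
  have U: "U \<le> 21 * ?\<tau>"
  proof -
    \<comment> \<open>\<open>37 / 5\<close> is a rational upper bound of the square of Euler's number.\<close>
    have e: "inverse \<rho> ^ (t - 1) \<le> 37 / 5"
    proof -
      have "inverse \<rho> ^ (t - 1) \<le> exp (2 / (real t - 1)) ^ (t - 1)"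
        unfolding inv using assms by (intro power_mono exp_ge_add_one_self) auto
      also have "\<dots> = exp 1 * exp 1"
      proof -
        have "x * (2 / x) = 1 + 1" if "x \<noteq> 0" for x :: real using that by simp
        from this[of "real (t - 1)"] have "real (t - 1) * (2 / (real t - 1)) = 1 + 1"
          using assms(3) by (simp only: of_nat_diff of_nat_1)
        then show ?thesis by (simp only: flip: exp_of_nat_mult exp_add)
      qed
      also have "\<dots> \<le> (272/100) * (272/100)"
        using e_less_272 by (intro mult_mono) auto
      finally show ?thesis by simp
    qed
    have "U = (\<Sum>j<t. (inverse \<rho> ^ (t - 1))\<^sup>2 * (\<rho>\<^sup>2) ^ j)"
      unfolding U_def
    proof (subst sum.nat_diff_reindex[symmetric], rule sum.cong)
      fix j assume "j \<in> {..<t}"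
      then have "(t - 1) * 2 = 2 * (t - Suc j) + 2 * j" by auto
      then have "(inverse \<rho> ^ (t - 1))\<^sup>2 = inverse \<rho> ^ (2 * (t - Suc j)) * inverse \<rho> ^ (2 * j)"
        by (metis power_add power_mult)
      then show "inverse \<rho> ^ (2 * (t - Suc j)) = (inverse \<rho> ^ (t - 1))\<^sup>2 * (\<rho>\<^sup>2) ^ j"
        using \<rho> by (simp add: power_inverse flip: power_mult)
    qed auto
    also have "\<dots> = (inverse \<rho> ^ (t - 1))\<^sup>2 * ((1 - (\<rho>\<^sup>2) ^ t) / (1 - \<rho>\<^sup>2))"
      using \<rho> power_less_one_iff[of \<rho> 2] by (simp add: sum_gp_strict flip: sum_distrib_left)
    also have "\<dots> \<le> (37 / 5)\<^sup>2 * (1 / (1 - \<rho>\<^sup>2))"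
      using e \<rho> power_less_one_iff[of \<rho> 2] power_le_one[of "\<rho>\<^sup>2" t]
      by (intro mult_mono power_mono divide_right_mono divide_nonneg_nonneg) auto
    also have "\<dots> = (37 / 5)\<^sup>2 / 4 * (?\<tau> / t) * ?\<tau>"
      unfolding gap by (simp add: power2_eq_square)
    also have "\<dots> \<le> (37 / 5)\<^sup>2 / 4 * (3 / 2) * ?\<tau>"
      using assms by (intro mult_right_mono mult_left_mono) (auto simp: field_simps)
    also have "\<dots> \<le> 21 * ?\<tau>" by (simp add: power2_eq_square)
    finally show ?thesis .
  qed
  have B: "sqrt (1 + \<rho>\<^sup>2) powr (m - 1) * (1 + \<rho>)\<^sup>2 \<le> 2 * sqrt 2 * sqrt 2 powr m"
  proof -
    have "(1 + \<rho>)\<^sup>2 \<le> 4" using \<rho> power_mono[of "1 + \<rho>" 2 2] by simp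
    moreover have "sqrt (1 + \<rho>\<^sup>2) powr (m - 1) \<le> sqrt 2 powr (m - 1)"
      using \<rho> m power_le_one[of \<rho> 2] by (intro powr_mono2) auto
    ultimately have "sqrt (1 + \<rho>\<^sup>2) powr (m - 1) * (1 + \<rho>)\<^sup>2 \<le> sqrt 2 powr (m - 1) * 4"
      by (intro mult_mono) auto
    also have "\<dots> = 2 * sqrt 2 * sqrt 2 powr m"
      by (simp add: powr_diff field_simps)
    finally show ?thesis .
  qed
  have "sqrt 2 powr m * sqrt X powr m = sqrt (2 * X) powr m"
    by (simp add: real_sqrt_mult powr_mult X_def sum_nonneg)
  also have "\<dots> \<le> sqrt (7 / 8 * (?\<tau> ^ 3 / 3)) powr m"
    using X m by (intro powr_mono2 real_sqrt_le_mono) (auto simp: X_def sum_nonneg)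
  also have "\<dots> = sqrt (7 / 8) powr m * sqrt (?\<tau> ^ 3 / 3) powr m"
    by (simp only: real_sqrt_mult powr_mult real_sqrt_ge_zero)
  also have "\<dots> \<le> sqrt (7 / 8) powr 4 * sqrt (?\<tau> ^ 3 / 3) powr m"
    using m by (intro mult_right_mono powr_mono') auto
  also have "sqrt (7 / 8) powr 4 = (7 / 8)\<^sup>2"
    by (simp add: powr_powr flip: powr_half_sqrt)
  finally have XX: "sqrt 2 powr m * sqrt X powr m \<le> (7 / 8)\<^sup>2 * sqrt (?\<tau> ^ 3 / 3) powr m" by simp
  have num: "2 * sqrt 2 * (7 / 8)\<^sup>2 * sqrt 21 \<le> 10"
  proof -
    have "sqrt 2 * sqrt 21 = sqrt 42" by (simp flip: real_sqrt_mult)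
    also have "\<dots> \<le> 65 / 10" by (rule real_le_lsqrt) (auto simp: power2_eq_square)
    finally show ?thesis by (simp add: power2_eq_square)
  qed
  have "chain_constant p \<nu> t \<rho> = sqrt (1 + \<rho>\<^sup>2) powr (m - 1) * (1 + \<rho>)\<^sup>2 * sqrt X powr m * sqrt U"
    by (simp add: chain_constant_def X_def U_def m_def)
  also have "\<dots> \<le> 2 * sqrt 2 * sqrt 2 powr m * sqrt X powr m * sqrt (21 * ?\<tau>)"
    using \<rho> U by (intro mult_mono B real_sqrt_le_mono order.refl) (auto simp: U_def sum_nonneg X_def)
  also have "\<dots> = 2 * sqrt 2 * sqrt 21 * (sqrt 2 powr m * sqrt X powr m) * sqrt ?\<tau>"
    unfolding real_sqrt_mult[of 21] by (simp only: mult_ac)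
  also have "\<dots> \<le> 2 * sqrt 2 * sqrt 21 * ((7 / 8)\<^sup>2 * sqrt (?\<tau> ^ 3 / 3) powr m) * sqrt ?\<tau>"
    by (intro mult_right_mono mult_left_mono XX) auto
  also have "\<dots> = (2 * sqrt 2 * (7 / 8)\<^sup>2 * sqrt 21) * (sqrt ?\<tau> * sqrt (?\<tau> ^ 3 / 3) powr m)"
    by (simp add: mult_ac)
  also have "\<dots> \<le> (2 powr ((2 + \<nu>) / 2) * (m + 1)) * (sqrt ?\<tau> * sqrt (?\<tau> ^ 3 / 3) powr m)"
  proof (rule mult_right_mono)
    have "10 \<le> 2 powr 1 * (m + 1)" using m by simp
    also have "\<dots> \<le> 2 powr ((2 + \<nu>) / 2) * (m + 1)"
      using m assms by (intro mult_right_mono powr_mono) auto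
    finally show "2 * sqrt 2 * (7 / 8)\<^sup>2 * sqrt 21 \<le> 2 powr ((2 + \<nu>) / 2) * (m + 1)" using num by linarith
  qed simp
  finally show ?thesis by (simp add: mult_ac add_ac)
qed

section \<open>The lower complexity bound\<close>

lemma orthonormal_family_exists:
  assumes "N \<le> DIM('a::euclidean_space)"
  obtains b :: "nat \<Rightarrow> 'a::euclidean_space" where "\<And>i j. b i \<bullet> b j = (if i = j \<and> i < N then 1 else 0)"
proof -
  obtain e :: "nat \<Rightarrow> 'a" where e: "bij_betw e {0..<DIM('a)} Basis"
    using ex_bij_betw_nat_finite[OF finite_Basis] by blast
  define b where "b j = (if j < N then e j else 0)" for j
  have "b i \<bullet> b j = (if i = j \<and> i < N then 1 else 0)" for i j
  proof (cases "i < N \<and> j < N")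
    case True
    then have "e i \<in> Basis" "e j \<in> Basis" "e i = e j \<longleftrightarrow> i = j"
      using e assms by (auto simp: bij_betw_def inj_on_def)
    then show ?thesis using True by (simp add: b_def inner_Basis)
  qed (auto simp: b_def)
  then show ?thesis by (rule that)
qed

text \<open>
  The power kernel settles \<open>\<nu> > 0\<close>. For \<open>\<nu> = 0\<close> the Hoelder constant of the ramp kernel is
  \<open>fact p\<close> divided by the sum of \<open>(1 - \<epsilon>) ^ j\<close> over \<open>j < p\<close>, which tends to \<open>fact p / p\<close> as \<open>\<epsilon>\<close> tends to 0.
\<close>

lemma rate_bound_all_orders:
  fixes M :: "'a::euclidean_space opt_method"
  assumes p: "1 \<le> p" and \<nu>: "0 \<le> \<nu>" "\<nu> \<le> 1" "2 \<le> real p + \<nu>"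
    and \<rho>: "0 < \<rho>" "\<rho> \<le> 1"
    and M: "tensor_method p \<nu> M" and N: "2 \<le> N" "N \<le> DIM('a)" and \<kappa>: "0 < \<kappa>"
    and rate: "\<And>f x0 xs. f \<in> problem_class p \<nu> \<Longrightarrow> global_minimizer f xs \<Longrightarrow>
           Min ((\<lambda>k. norm (gradient f (M f x0 k))) ` {1..N - 1})
             \<le> enn2real (holder_const p \<nu> f) * norm (x0 - xs) powr (real p + \<nu> - 1) / \<kappa>"
  shows "\<kappa> \<le> (\<Prod>i=1..<p. real p + \<nu> - real i) * chain_constant p \<nu> N \<rho>"
proof -
  obtain b :: "nat \<Rightarrow> 'a" where b: "b i \<bullet> b j = (if i = j \<and> i < N then 1 else 0)" for i j
    using orthonormal_family_exists[OF N(2)] by blast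
  have kernel: "\<kappa> \<le> C * chain_constant p \<nu> N \<rho>" if "ridge_kernel p \<nu> C g" for C g
  proof -
    interpret chain_function p \<nu> C g b N \<rho>
      using that N \<rho> b by (simp add: chain_function_def chain_function_axioms_def)
    show ?thesis by (rule rate_bound[OF M N(1) \<kappa> rate])
  qed
  show ?thesis
  proof (cases "\<nu> = 0")
    case False
    then show ?thesis using kernel[OF ridge_kernel_power] p \<nu> by simp
  next
    case True
    let ?D = "chain_constant p \<nu> N \<rho>"
    have p2: "2 \<le> p" using True \<nu> by simp
    have bound: "\<kappa> * (\<Sum>j<p. (1 - \<epsilon>) ^ j) \<le> fact p * ?D" if \<epsilon>: "0 < \<epsilon>" "\<epsilon> < 1" for \<epsilon>
    proof -
      let ?s = "\<Sum>j<p. (1 - \<epsilon>) ^ j"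
      have s: "0 < ?s"
        using \<epsilon> p by (intro sum_pos) (auto simp: lessThan_empty_iff)
      have geometric: "1 - (1 - \<epsilon>) ^ p = \<epsilon> * ?s"
        using one_diff_power_eq[of "1 - \<epsilon>" p] by simp
      have "\<kappa> \<le> fact p * \<epsilon> / (1 - (1 - \<epsilon>) ^ p) * ?D"
        by (rule kernel[unfolded True, OF ridge_kernel_ramp[OF p2 \<epsilon>], folded True])
      also have "\<dots> = fact p * ?D / ?s"
        unfolding geometric using \<epsilon> by simp
      finally show ?thesis using s by (simp add: pos_le_divide_eq)
    qed
    have "((\<lambda>\<epsilon>. \<kappa> * (\<Sum>j<p. (1 - \<epsilon>) ^ j)) \<longlongrightarrow> \<kappa> * (\<Sum>j<p. (1 - 0) ^ j)) (at_right 0)"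
      by (intro tendsto_intros)
    moreover have "\<forall>\<^sub>F \<epsilon> in at_right 0. \<kappa> * (\<Sum>j<p. (1 - \<epsilon>) ^ j) \<le> fact p * ?D"
      using eventually_at_right_real[of 0 1] by (auto elim!: eventually_mono intro: bound)
    ultimately have "\<kappa> * (\<Sum>j<p. (1 - 0) ^ j) \<le> fact p * ?D"
      by (intro tendsto_upperbound) auto
    also have "(fact p :: real) = (\<Prod>i=0..<p. real p - real i)"
      by (auto simp: fact_prod_rev of_nat_diff intro!: prod.cong)
    also have "\<dots> = real p * (\<Prod>i=1..<p. real p - real i)"
      using p by (simp add: prod.atLeast_Suc_lessThan[of 0 p])
    finally show ?thesis using p True by (simp add: mult.assoc mult.commute[of \<kappa>])
  qed
qed

theorem theorem6p7:
  fixes p :: nat and \<nu> :: real and \<kappa> :: "nat \<Rightarrow> real" and M :: "(real ^ 'n) opt_method"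
  assumes "p \<ge> 1" and "0 \<le> \<nu>" and "\<nu> \<le> 1" and "real p + \<nu> \<ge> 2"
    and "\<And>t. t \<ge> 2 \<Longrightarrow> \<kappa> t > 0"
    and "tensor_method p \<nu> M"
    and rate: "\<And>f x0 xs t. f \<in> problem_class p \<nu> \<Longrightarrow> global_minimizer f xs \<Longrightarrow> t \<ge> 2 \<Longrightarrow>
           Min ((\<lambda>k. norm (gradient f (M f x0 k))) ` {1..t - 1})
             \<le> enn2real (holder_const p \<nu> f) * norm (x0 - xs) powr (real p + \<nu> - 1) / \<kappa> t"
  shows "\<forall>t::nat. t \<ge> 2 \<and> t + 1 \<le> CARD('n) \<longrightarrow>
           \<kappa> t \<le> lower_const p \<nu> * real (t + 1) powr ((3 * (real p + \<nu>) - 2) / 2)"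
proof (intro allI impI, elim conjE)
  fix t :: nat
  assume t: "2 \<le> t" "t + 1 \<le> CARD('n)"
  define m where "m = real p + \<nu> - 1"
  define c where "c = (\<Prod>i=1..<p. real p + \<nu> - real i)"
  have c: "0 \<le> c" unfolding c_def using assms(1,2) by (intro prod_nonneg) auto
  let ?\<tau> = "real (t + 1)"
  obtain \<rho> where \<rho>: "0 < \<rho>" "\<rho> \<le> 1" and const: "chain_constant p \<nu> t \<rho>
      \<le> 2 powr ((2 + \<nu>) / 2) * (m + 1) * sqrt ?\<tau> * sqrt (?\<tau> ^ 3 / 3) powr m"
  proof (cases "p \<le> 4")
    case True
    show ?thesis
      by (rule that[of 1], simp, simp)
        (unfold m_def, rule balanced_chain_constant[OF assms(1) True assms(2,4)])
  next
    case False
    show ?thesis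
    proof (rule that)
      show "0 < (real t - 1) / (real t + 1)" "(real t - 1) / (real t + 1) \<le> 1" using t by auto
    qed (unfold m_def, rule damped_chain_constant[OF _ assms(2) t(1)], use False in simp)
  qed
  have "\<kappa> t \<le> c * chain_constant p \<nu> t \<rho>"
    unfolding c_def using t assms(5)[OF t(1)]
    by (intro rate_bound_all_orders[OF assms(1-4) \<rho> assms(6)] rate) auto
  also have "\<dots> \<le> c * (2 powr ((2 + \<nu>) / 2) * (m + 1) * sqrt ?\<tau> * sqrt (?\<tau> ^ 3 / 3) powr m)"
    using const c by (rule mult_left_mono)
  also have "sqrt (?\<tau> ^ 3 / 3) powr m = ?\<tau> powr (3 * m / 2) * 3 powr (- (m / 2))"
  proof -
    have "sqrt (x ^ 3 / 3) powr m = x powr (3 * m / 2) * 3 powr (- (m / 2))" if "0 < x" for x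
    proof -
      have "sqrt (x ^ 3 / 3) powr m = ((x ^ 3 / 3) powr (1 / 2)) powr m"
        using that by (subst powr_half_sqrt) auto
      also have "\<dots> = (x powr 3 / 3) powr (m / 2)"
        using that by (simp add: powr_powr powr_numeral)
      also have "\<dots> = x powr (3 * m / 2) / 3 powr (m / 2)"
        by (simp add: powr_divide powr_powr)
      finally show ?thesis by (simp only: powr_minus_divide) simp
    qed
    then show ?thesis by simp
  qed
  also have "c * (2 powr ((2 + \<nu>) / 2) * (m + 1) * sqrt ?\<tau> * (?\<tau> powr (3 * m / 2) * 3 powr (- (m / 2))))
      = 2 powr ((2 + \<nu>) / 2) * 3 powr (- (m / 2)) * ((m + 1) * c) * (?\<tau> powr (1 / 2) * ?\<tau> powr (3 * m / 2))"
    by (subst powr_half_sqrt) (simp_all only: mult_ac of_nat_0_le_iff)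
  also have "?\<tau> powr (1 / 2) * ?\<tau> powr (3 * m / 2) = ?\<tau> powr ((3 * (real p + \<nu>) - 2) / 2)"
    unfolding powr_add[symmetric] by (simp add: m_def field_simps)
  also have "(m + 1) * c = (\<Prod>i=0..<p. real p + \<nu> - real i)"
    using assms(1) by (simp add: c_def m_def prod.atLeast_Suc_lessThan[of 0 p])
  finally show "\<kappa> t \<le> lower_const p \<nu> * ?\<tau> powr ((3 * (real p + \<nu>) - 2) / 2)"
    by (simp add: lower_const_def m_def)
qed

end
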